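(* Assume the Generalized Continuum Hypothesis (GCH). If $X$ is an infinite $T_0$ topological space with $|X|=2^{w(X)}$, then $\operatorname{sm}(X)=w(X)$.
   Context: Set membership game $G_\beta(Y,X)$ ($X$ a topological space, $Y\subseteq X$, $\beta$ an ordinal): two players, Seeker and Hider, make $\beta$ moves. At move $\alpha<\beta$, knowing all previous moves, the Seeker chooses an open set $U_\alpha\subseteq X$, and then the Hider chooses $V_\alpha\in\{U_\alpha, X\setminus U_\alpha\}$. The outcome is $W=\bigcap_{\alpha<\beta}V_\alpha$ (with $W=X$ if $\beta=0$). The Seeker wins iff $W\subseteq Y$ or $W\cap Y=\emptyset$. For a $T_0$ space $X$: $\operatorname{sm}(Y,X)$ is the least ordinal $\beta$ such that the Seeker has a winning strategy in $G_\beta(Y,X)$, and $\operatorname{sm}(X)=\sup\{\operatorname{sm}(Y,X):Y\subseteq X\}$ (an ordinal). $w(X)$ denotes the weight of $X$. *)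

theory Defs
  imports "HOL-Analysis.Abstract_Topological_Spaces" "HOL-Library.FuncSet"
begin

unbundle cardinal_syntax

text \<open>
  An ordinal is represented by a well-order, taken up to isomorphism \<open>=o\<close>; the moves of a game
  of length \<open>\<beta>\<close> are indexed by \<open>Field \<beta>\<close>, and the moves preceding move \<open>\<alpha>\<close>
  by \<open>underS \<beta> \<alpha>\<close>. Cardinals are initial ordinals (\<open>Card_order\<close>).

  The generalized continuum hypothesis can be stated in HOL only for the cardinals that live on a
  given type. The following asserts it for all infinite cardinals not exceeding the cardinality
  of that type.
\<close>

definition GCH :: "'u itself \<Rightarrow> bool" where
  "GCH (_ :: 'u itself) \<longleftrightarrow>
     (\<forall>\<kappa> :: 'u rel. Card_order \<kappa> \<and> infinite (Field \<kappa>) \<longrightarrow>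
        ctwo ^c \<kappa> =o cardSuc \<kappa>)"

text \<open>
  \<open>restrict (\<lambda>\<xi>. (U \<xi>, V \<xi>)) (underS \<beta> \<alpha>)\<close> is the position in front of move \<open>\<alpha>\<close>: the
  sequence of all previous moves of both players. A strategy \<open>\<sigma>\<close> of the Seeker assigns an
  open set to every move index and position.
\<close>

type_synonym ('i, 'a) seeker_strategy = "'i \<Rightarrow> ('i \<Rightarrow> 'a set \<times> 'a set) \<Rightarrow> 'a set"

definition is_play ::
    "'i rel \<Rightarrow> 'a topology \<Rightarrow> ('i, 'a) seeker_strategy \<Rightarrow> ('i \<Rightarrow> 'a set) \<Rightarrow> ('i \<Rightarrow> 'a set) \<Rightarrow> bool" where
  "is_play \<beta> X \<sigma> U V \<longleftrightarrow>
     (\<forall>\<alpha> \<in> Field \<beta>. U \<alpha> = \<sigma> \<alpha> (restrict (\<lambda>\<xi>. (U \<xi>, V \<xi>)) (underS \<beta> \<alpha>)) \<and>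
                     V \<alpha> \<in> {U \<alpha>, topspace X - U \<alpha>})"

definition outcome :: "'i rel \<Rightarrow> 'a topology \<Rightarrow> ('i \<Rightarrow> 'a set) \<Rightarrow> 'a set" where
  "outcome \<beta> X V = topspace X \<inter> (\<Inter>\<alpha> \<in> Field \<beta>. V \<alpha>)"

definition winning_strategy ::
    "'i rel \<Rightarrow> 'a set \<Rightarrow> 'a topology \<Rightarrow> ('i, 'a) seeker_strategy \<Rightarrow> bool" where
  "winning_strategy \<beta> Y X \<sigma> \<longleftrightarrow>
     (\<forall>\<alpha> \<in> Field \<beta>. \<forall>h. openin X (\<sigma> \<alpha> h)) \<and>
     (\<forall>U V. is_play \<beta> X \<sigma> U V \<longrightarrow> outcome \<beta> X V \<subseteq> Y \<or> outcome \<beta> X V \<inter> Y = {})"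

definition seeker_wins :: "'i rel \<Rightarrow> 'a set \<Rightarrow> 'a topology \<Rightarrow> bool" where
  "seeker_wins \<beta> Y X \<longleftrightarrow> (\<exists>\<sigma>. winning_strategy \<beta> Y X \<sigma>)"

text \<open>The least ordinal with a given property, as a well-order determined up to isomorphism.\<close>

definition least_ordinal :: "('i rel \<Rightarrow> bool) \<Rightarrow> 'i rel" where
  "least_ordinal P =
     (SOME r. Well_order r \<and> P r \<and> (\<forall>s. Well_order s \<and> P s \<longrightarrow> r \<le>o s))"

lemma least_ordinal:
  assumes "Well_order r" "P r"
  shows "Well_order (least_ordinal P)" "P (least_ordinal P)"
    and "\<And>s. Well_order s \<Longrightarrow> P s \<Longrightarrow> least_ordinal P \<le>o s"
proof -
  have "\<exists>r. Well_order r \<and> P r \<and> (\<forall>s. Well_order s \<and> P s \<longrightarrow> r \<le>o s)"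
    using exists_minim_Well_order[of "{r. Well_order r \<and> P r}"] assms by blast
  then have "Well_order (least_ordinal P) \<and> P (least_ordinal P) \<and>
      (\<forall>s. Well_order s \<and> P s \<longrightarrow> least_ordinal P \<le>o s)"
    unfolding least_ordinal_def by (rule someI_ex)
  then show "Well_order (least_ordinal P)" "P (least_ordinal P)"
    and "\<And>s. Well_order s \<Longrightarrow> P s \<Longrightarrow> least_ordinal P \<le>o s" by blast+
qed

definition is_base :: "'a topology \<Rightarrow> 'a set set \<Rightarrow> bool" where
  "is_base X \<B> \<longleftrightarrow> (\<forall>V \<in> \<B>. openin X V) \<and>
     (\<forall>U x. openin X U \<and> x \<in> U \<longrightarrow> (\<exists>V \<in> \<B>. x \<in> V \<and> V \<subseteq> U))"

definition weight :: "'a topology \<Rightarrow> 'a set rel" where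
  "weight X = least_ordinal (\<lambda>\<kappa>. \<exists>\<B>. is_base X \<B> \<and> \<kappa> =o |\<B>| )"

text \<open>
  Well-orders on the type of sets of points suffice in the next two definitions: in a
  \<open>T\<^sub>0\<close> space the Seeker wins by asking for the members of a base one after the other
  (\<open>seeker_wins_base\<close> below), and the value so obtained is least among the ordinals
  on any type whatsoever (\<open>sm_set_least\<close> below).
\<close>

definition sm_set :: "'a set \<Rightarrow> 'a topology \<Rightarrow> 'a set rel" where
  "sm_set Y X = least_ordinal (\<lambda>\<beta>. seeker_wins \<beta> Y X)"

text \<open>The supremum of a set of ordinals is their least upper bound.\<close>

definition sm :: "'a topology \<Rightarrow> 'a set rel" where
  "sm X = least_ordinal (\<lambda>\<beta>. \<forall>Y. Y \<subseteq> topspace X \<longrightarrow> sm_set Y X \<le>o \<beta>)"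

lemma seeker_wins_base:
  assumes "t0_space X" "is_base X \<B>"
  shows "seeker_wins |\<B>| Y X"
proof -
  define \<sigma> :: "('a set, 'a) seeker_strategy" where "\<sigma> = (\<lambda>\<alpha> h. \<alpha>)"
  have "outcome |\<B>| X V \<subseteq> Y \<or> outcome |\<B>| X V \<inter> Y = {}" if "is_play |\<B>| X \<sigma> U V" for U V
  proof -
    have V: "V B = B \<or> V B = topspace X - B" if "B \<in> \<B>" for B
      using \<open>is_play |\<B>| X \<sigma> U V\<close> that by (auto simp: is_play_def \<sigma>_def Field_card_of)
    have "x = y" if xy: "x \<in> outcome |\<B>| X V" "y \<in> outcome |\<B>| X V" for x y
    proof (rule ccontr)
      assume "x \<noteq> y"
      have mem: "x \<in> topspace X" "y \<in> topspace X" "\<And>B. B \<in> \<B> \<Longrightarrow> x \<in> V B \<and> y \<in> V B"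
        using xy by (auto simp: outcome_def Field_card_of)
      have same: "x \<in> B \<longleftrightarrow> y \<in> B" if "B \<in> \<B>" for B
        using V[OF that] mem(3)[OF that] by auto
      obtain W where "openin X W" "x \<notin> W \<longleftrightarrow> y \<in> W"
        using assms(1) mem(1,2) \<open>x \<noteq> y\<close> unfolding t0_space_def by metis
      then show False
        using assms(2) same unfolding is_base_def by (metis subsetD)
    qed
    then show ?thesis by blast
  qed
  moreover have "\<forall>\<alpha> \<in> Field |\<B>|. \<forall>h. openin X (\<sigma> \<alpha> h)"
    using assms(2) by (simp add: is_base_def \<sigma>_def Field_card_of)
  ultimately show ?thesis
    unfolding seeker_wins_def winning_strategy_def by blast
qed

lemma seeker_wins_iso:
  fixes r :: "'i rel" and s :: "'j rel"
  assumes "s =o r" "seeker_wins s Y X"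
  shows "seeker_wins r Y X"
proof -
  obtain f where wo: "Well_order s" "Well_order r" and f: "iso s r f"
    using assms(1) unfolding ordIso_def by auto
  have bij: "bij_betw f (Field s) (Field r)"
    using f by (simp add: iso_def)
  have inj: "inj_on f (Field s)" and img: "f ` Field s = Field r"
    using bij by (auto simp: bij_betw_def)
  have mono: "(a, b) \<in> s \<longleftrightarrow> (f a, f b) \<in> r" if "a \<in> Field s" "b \<in> Field s" for a b
    using f that wo iso_forward iso_iff2[of s r f] by blast
  have under: "f j' \<in> underS r (f j)" if "j \<in> Field s" "j' \<in> underS s j" for j j'
  proof -
    have "j' \<in> Field s" "j' \<noteq> j" "(j', j) \<in> s"
      using that(2) by (auto simp: underS_def Field_def)
    then show ?thesis
      using that(1) mono inj by (auto simp: underS_def inj_on_eq_iff)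
  qed
  define g where "g = inv_into (Field s) f"
  have gf: "g (f j) = j" if "j \<in> Field s" for j
    using that inj by (simp add: g_def)
  have gin: "g i \<in> Field s" if "i \<in> Field r" for i
    using that img by (simp add: g_def inv_into_into)
  obtain \<sigma> where \<sigma>: "winning_strategy s Y X \<sigma>"
    using assms(2) by (auto simp: seeker_wins_def)
  define \<tau> :: "('i, 'a) seeker_strategy" where
    "\<tau> = (\<lambda>i h. \<sigma> (g i) (restrict (\<lambda>j. h (f j)) (underS s (g i))))"
  have "outcome r X V \<subseteq> Y \<or> outcome r X V \<inter> Y = {}" if play: "is_play r X \<tau> U V" for U V
  proof -
    have "is_play s X \<sigma> (U \<circ> f) (V \<circ> f)"
      unfolding is_play_def
    proof
      fix j assume j: "j \<in> Field s"
      then have fj: "f j \<in> Field r"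
        using img by auto
      have "restrict (\<lambda>j'. restrict (\<lambda>\<xi>. (U \<xi>, V \<xi>)) (underS r (f j)) (f j')) (underS s j)
          = restrict (\<lambda>\<xi>. ((U \<circ> f) \<xi>, (V \<circ> f) \<xi>)) (underS s j)"
        using under[OF j] by (auto simp: restrict_def fun_eq_iff)
      then show "(U \<circ> f) j = \<sigma> j (restrict (\<lambda>\<xi>. ((U \<circ> f) \<xi>, (V \<circ> f) \<xi>)) (underS s j)) \<and>
          (V \<circ> f) j \<in> {(U \<circ> f) j, topspace X - (U \<circ> f) j}"
        using play[unfolded is_play_def \<tau>_def, rule_format, OF fj] gf[OF j]
        by (auto simp del: restrict_apply)
    qed
    moreover have "outcome s X (V \<circ> f) = outcome r X V"
      by (simp add: outcome_def flip: img)
    ultimately show ?thesis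
      using \<sigma> unfolding winning_strategy_def by metis
  qed
  moreover have "\<forall>i \<in> Field r. \<forall>h. openin X (\<tau> i h)"
    using \<sigma> gin by (simp add: winning_strategy_def \<tau>_def)
  ultimately show ?thesis
    unfolding seeker_wins_def winning_strategy_def by blast
qed

lemma sm_set_least:
  fixes s :: "'j rel"
  assumes "t0_space X" "Well_order s" "seeker_wins s Y X"
  shows "Well_order (sm_set Y X)" "seeker_wins (sm_set Y X) Y X" "sm_set Y X \<le>o s"
proof -
  have "is_base X {U. openin X U}"
    by (auto simp: is_base_def)
  note wins = seeker_wins_base[OF assms(1) this, of Y]
  note least = least_ordinal[of "|{U. openin X U}|" "\<lambda>\<beta>. seeker_wins \<beta> Y X",
      OF card_of_Well_order wins, folded sm_set_def]
  show wo: "Well_order (sm_set Y X)" and "seeker_wins (sm_set Y X) Y X"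
    using least by blast+
  show "sm_set Y X \<le>o s"
  proof (rule ccontr)
    assume "\<not> ?thesis"
    then have "s <o sm_set Y X"
      using wo assms(2) by (simp add: not_ordLeq_iff_ordLess)
    then obtain p where "p \<in> Field (sm_set Y X)"
      and iso: "s =o Restr (sm_set Y X) (underS (sm_set Y X) p)"
      using assms(2) wo ordLess_iff_ordIso_Restr by blast
    moreover have "Well_order (Restr (sm_set Y X) (underS (sm_set Y X) p))"
      using wo by (rule Well_order_Restr)
    ultimately have "sm_set Y X \<le>o Restr (sm_set Y X) (underS (sm_set Y X) p)"
      using least(3) seeker_wins_iso[OF iso assms(3)] by blast
    then show False
      using \<open>s <o sm_set Y X\<close> iso
      by (meson not_ordLess_ordLeq ordIso_symmetric ordLeq_ordIso_trans)
  qed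
qed

end

theory Submission
  imports Defs
begin

text \<open>
  The proof counts. If the Seeker wins \<open>G\<^sub>\<beta>(Y,X)\<close>, then the outcomes of the plays against the
  possible choice sequences of the Hider partition \<open>X\<close>, and \<open>Y\<close> is a union of them. When
  \<open>\<beta> < w(X)\<close>, GCH leaves at most \<open>2\<^bsup>|\<beta>|\<^esup> \<le> w(X)\<close> choice sequences, so the Seeker's answers to
  them, each a union of members of a base of size \<open>w(X)\<close>, can be prescribed in at most
  \<open>2\<^bsup>w(X)\<^esup>\<close> ways. Hence only \<open>2\<^bsup>w(X)\<^esup> = |X|\<close> of the subsets of \<open>X\<close> can be decided in fewer than
  \<open>w(X)\<close> moves.
\<close>

text \<open>The play comes from well-founded recursion along \<open>r\<close>. The Hider's rule
  \<open>c\<close> may inspect the proposed set, so it covers both a fixed choice sequence and a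
  Hider who follows a given point.\<close>

lemma is_play_exists:
  fixes c :: "'i \<Rightarrow> 'a set \<Rightarrow> bool"
  assumes "Well_order r"
  obtains U V where "is_play r X \<sigma> U V"
    and "\<And>\<alpha>. V \<alpha> = (if c \<alpha> (U \<alpha>) then U \<alpha> else topspace X - U \<alpha>)"
proof -
  have wf: "wf (r - Id)"
    using assms by (simp add: well_order_on_def)
  define G where "G = (\<lambda>f \<alpha>. let u = \<sigma> \<alpha> (restrict f (underS r \<alpha>))
    in (u, if c \<alpha> u then u else topspace X - u))"
  define f where "f = wfrec (r - Id) G"
  \<comment> \<open>\<open>G\<close> consults only earlier moves, where the cut made by
    \<open>wfrec\<close> changes nothing.\<close>
  have "restrict (cut f (r - Id) \<alpha>) (underS r \<alpha>) = restrict f (underS r \<alpha>)" for \<alpha>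
    by (auto simp: fun_eq_iff cut_def underS_def)
  then have f: "f \<alpha> = G f \<alpha>" for \<alpha>
    using wfrec[OF wf, of G \<alpha>, folded f_def] by (simp add: G_def)
  show thesis
  proof
    show "(snd \<circ> f) \<alpha> = (if c \<alpha> ((fst \<circ> f) \<alpha>) then (fst \<circ> f) \<alpha> else topspace X - (fst \<circ> f) \<alpha>)" for \<alpha>
      using f[of \<alpha>] by (simp add: G_def Let_def)
    then have "(snd \<circ> f) \<alpha> \<in> {(fst \<circ> f) \<alpha>, topspace X - (fst \<circ> f) \<alpha>}" for \<alpha>
      by (simp only: insert_iff) auto
    moreover have "(fst \<circ> f) \<alpha> = \<sigma> \<alpha> (restrict f (underS r \<alpha>))" for \<alpha>
      using f[of \<alpha>] by (simp add: G_def Let_def)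
    moreover have "(\<lambda>\<xi>. ((fst \<circ> f) \<xi>, (snd \<circ> f) \<xi>)) = f"
      by simp
    ultimately show "is_play r X \<sigma> (fst \<circ> f) (snd \<circ> f)"
      unfolding is_play_def by (intro ballI conjI) (simp_all only:)
  qed
qed

text \<open>By induction along \<open>r\<close>: equal earlier moves give equal positions, to which
  \<open>\<sigma>\<close> gives one answer. So a play can be indexed by its choice sequence
  \<open>S\<close> alone.\<close>

lemma is_play_unique:
  assumes "Well_order r" "is_play r X \<sigma> U V" "is_play r X \<sigma> U' V'"
    and V: "\<And>\<alpha>. \<alpha> \<in> Field r \<Longrightarrow> V \<alpha> = (if \<alpha> \<in> S then U \<alpha> else topspace X - U \<alpha>)"
    and V': "\<And>\<alpha>. \<alpha> \<in> Field r \<Longrightarrow> V' \<alpha> = (if \<alpha> \<in> S then U' \<alpha> else topspace X - U' \<alpha>)"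
    and "\<alpha> \<in> Field r"
  shows "U \<alpha> = U' \<alpha>"
proof -
  have "wf (r - Id)"
    using assms(1) by (simp add: well_order_on_def)
  then show ?thesis
    using \<open>\<alpha> \<in> Field r\<close>
  proof (induction \<alpha>)
    case (less \<alpha>)
    have "U \<xi> = U' \<xi> \<and> V \<xi> = V' \<xi>" if "\<xi> \<in> underS r \<alpha>" for \<xi>
    proof -
      have "(\<xi>, \<alpha>) \<in> r - Id" "\<xi> \<in> Field r"
        using that by (auto simp: underS_def Field_def)
      then show ?thesis
        using less.IH V V' by simp
    qed
    then have "restrict (\<lambda>\<xi>. (U \<xi>, V \<xi>)) (underS r \<alpha>) = restrict (\<lambda>\<xi>. (U' \<xi>, V' \<xi>)) (underS r \<alpha>)"
      by (auto simp: fun_eq_iff)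
    then show ?case
      using assms(2,3) less.prems by (simp add: is_play_def)
  qed
qed

text \<open>
  A code \<open>(R, T)\<close> describes a set won by the Seeker: against the Hider who agrees to the open set
  proposed at move \<open>\<alpha>\<close> exactly when \<open>\<alpha> \<in> S\<close>, the Seeker's move \<open>\<alpha>\<close> is the union of the base
  sets that \<open>R\<close> relates to \<open>(\<alpha>, S)\<close>; the choice sequences \<open>S\<close> in \<open>T\<close> are those with outcome
  inside the set.
\<close>

definition decode ::
    "'i set \<Rightarrow> 'a set \<Rightarrow> (('i \<times> 'i set) \<times> 'a set) set \<times> 'i set set \<Rightarrow> 'a set" where
  "decode I A = (\<lambda>(R, T). \<Union>S \<in> T. {x \<in> A. \<forall>\<alpha> \<in> I. x \<in> \<Union>(R `` {(\<alpha>, S)}) \<longleftrightarrow> \<alpha> \<in> S})"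

text \<open>Every point lies in the outcome of some choice sequence, and a winning strategy puts
  each outcome inside \<open>Y\<close> or outside it, so \<open>Y\<close> is the union of the
  outcomes it contains.\<close>

lemma seeker_wins_decode:
  assumes r: "Well_order r" and B: "is_base X \<B>"
    and "seeker_wins r Y X" "Y \<subseteq> topspace X"
  shows "Y \<in> decode (Field r) (topspace X) `
    (Pow ((Field r \<times> Pow (Field r)) \<times> \<B>) \<times> Pow (Pow (Field r)))"
proof -
  obtain \<sigma> where \<sigma>: "winning_strategy r Y X \<sigma>"
    using assms(3) by (auto simp: seeker_wins_def)
  have "\<exists>U V. is_play r X \<sigma> U V \<and> (\<forall>\<alpha>. V \<alpha> = (if \<alpha> \<in> S then U \<alpha> else topspace X - U \<alpha>))" for S
    using is_play_exists[OF r, of X \<sigma> "\<lambda>\<alpha> _. \<alpha> \<in> S"] by metis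
  then obtain U V where play: "\<And>S. is_play r X \<sigma> (U S) (V S)"
    and V: "\<And>S \<alpha>. V S \<alpha> = (if \<alpha> \<in> S then U S \<alpha> else topspace X - U S \<alpha>)"
    by metis
  have op: "openin X (U S \<alpha>)" if "\<alpha> \<in> Field r" for S \<alpha>
    using play[of S] \<sigma> that by (simp add: is_play_def winning_strategy_def)
  have outcome: "outcome r X (V S) = {x \<in> topspace X. \<forall>\<alpha> \<in> Field r. x \<in> U S \<alpha> \<longleftrightarrow> \<alpha> \<in> S}" for S
    by (auto simp: outcome_def V split: if_splits)
  have cover: "\<exists>S \<subseteq> Field r. x \<in> outcome r X (V S)" if x: "x \<in> topspace X" for x
  proof -
    \<comment> \<open>The Hider always answers with the part containing \<open>x\<close>; by
      uniqueness this is the play indexed by the moves agreed to.\<close>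
    obtain U' V' where play': "is_play r X \<sigma> U' V'"
      and V': "\<And>\<alpha>. V' \<alpha> = (if x \<in> U' \<alpha> then U' \<alpha> else topspace X - U' \<alpha>)"
      using is_play_exists[OF r, of X \<sigma> "\<lambda>_ u. x \<in> u"] by metis
    define S where "S = {\<alpha> \<in> Field r. x \<in> U' \<alpha>}"
    have "U S \<alpha> = U' \<alpha>" if "\<alpha> \<in> Field r" for \<alpha>
      by (rule is_play_unique[OF r play[of S] play', where S = S]) (use that in \<open>auto simp: V V' S_def\<close>)
    then have "x \<in> outcome r X (V S)"
      using x by (auto simp: outcome S_def)
    moreover have "S \<subseteq> Field r"
      by (auto simp: S_def)
    ultimately show ?thesis
      by blast
  qed
  \<comment> \<open>All base members inside the open set \<open>U S \<alpha>\<close> are recorded,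
    so that their union restores it.\<close>
  define R where "R = {((\<alpha>, S), b). \<alpha> \<in> Field r \<and> S \<subseteq> Field r \<and> b \<in> \<B> \<and> b \<subseteq> U S \<alpha>}"
  define T where "T = {S. S \<subseteq> Field r \<and> outcome r X (V S) \<subseteq> Y}"
  have R: "\<Union>(R `` {(\<alpha>, S)}) = U S \<alpha>" if "\<alpha> \<in> Field r" "S \<subseteq> Field r" for \<alpha> S
  proof -
    have "R `` {(\<alpha>, S)} = {b \<in> \<B>. b \<subseteq> U S \<alpha>}"
      using that by (auto simp: R_def)
    moreover have "\<exists>b \<in> \<B>. x \<in> b \<and> b \<subseteq> U S \<alpha>" if "x \<in> U S \<alpha>" for x
      using B op[OF \<open>\<alpha> \<in> Field r\<close>] that by (simp add: is_base_def)
    ultimately show ?thesis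
      by (simp only:) blast
  qed
  have "decode (Field r) (topspace X) (R, T) = (\<Union>S\<in>T. outcome r X (V S))"
    unfolding decode_def outcome split
    by (intro SUP_cong Collect_cong conj_cong ball_cong refl) (use R in \<open>simp only: T_def mem_Collect_eq\<close>)
  also have "\<dots> = Y"
  proof
    show "Y \<subseteq> (\<Union>S\<in>T. outcome r X (V S))"
    proof
      fix y assume y: "y \<in> Y"
      then obtain S where S: "S \<subseteq> Field r" "y \<in> outcome r X (V S)"
        using cover assms(4) by blast
      then have "outcome r X (V S) \<subseteq> Y"
        using \<sigma> play[of S] y unfolding winning_strategy_def by blast
      then show "y \<in> (\<Union>S\<in>T. outcome r X (V S))"
        using S by (auto simp: T_def)
    qed
  qed (auto simp: T_def)
  finally have "Y = decode (Field r) (topspace X) (R, T)" ..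
  moreover have "R \<subseteq> (Field r \<times> Pow (Field r)) \<times> \<B>" "T \<subseteq> Pow (Field r)"
    by (auto simp: R_def T_def)
  ultimately show ?thesis
    by (intro image_eqI[of _ _ "(R, T)"]) auto
qed

lemma card_of_Pow_mono:
  assumes "|A| \<le>o |B|"
  shows "|Pow A| \<le>o |Pow B|"
proof -
  obtain f where "inj_on f A" "f ` A \<subseteq> B"
    using assms card_of_ordLeq[of A B] by blast
  then have "inj_on ((`) f) (Pow A)" "(`) f ` Pow A \<subseteq> Pow B"
    by (auto simp: inj_on_image_Pow image_Pow_mono)
  then show ?thesis
    using card_of_ordLeq by blast
qed

text \<open>The sets won are decoded from pairs of subsets of sets of size at most
  \<open>|\<B>|\<close>, and there are at most \<open>|Pow \<B>|\<close> such pairs.\<close>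

lemma card_of_seeker_wins_le:
  assumes "Well_order r" "is_base X \<B>" "infinite \<B>" "|Pow (Field r)| \<le>o |\<B>|"
  shows "|{Y. Y \<subseteq> topspace X \<and> seeker_wins r Y X}| \<le>o |Pow \<B>|"
proof -
  let ?F = "Field r"
  have F: "|?F| \<le>o |\<B>|"
    using assms(4) card_of_Pow ordLess_imp_ordLeq ordLeq_transitive by blast
  have "|?F \<times> Pow ?F| \<le>o |\<B>|"
    using assms(3,4) F by (intro card_of_Sigma_ordLeq_infinite) auto
  then have "|(?F \<times> Pow ?F) \<times> \<B>| \<le>o |\<B>|"
    by (rule card_of_Sigma_ordLeq_infinite[OF assms(3)]) (simp add: card_of_mono1)
  then have R: "|Pow ((?F \<times> Pow ?F) \<times> \<B>)| \<le>o |Pow \<B>|"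
    by (rule card_of_Pow_mono)
  have T: "|Pow (Pow ?F)| \<le>o |Pow \<B>|"
    using assms(4) by (rule card_of_Pow_mono)
  have codes: "|Pow ((?F \<times> Pow ?F) \<times> \<B>) \<times> Pow (Pow ?F)| \<le>o |Pow \<B>|"
    using assms(3) R T by (intro card_of_Sigma_ordLeq_infinite) auto
  have "{Y. Y \<subseteq> topspace X \<and> seeker_wins r Y X} \<subseteq> decode ?F (topspace X) `
      (Pow ((?F \<times> Pow ?F) \<times> \<B>) \<times> Pow (Pow ?F))"
    using seeker_wins_decode[OF assms(1,2)] by blast
  then show ?thesis
    by (rule ordLeq_transitive[OF card_of_mono1 ordLeq_transitive[OF card_of_image codes]])
qed

lemma card_of_Pow_cexp_ctwo: "|Pow A| =o ctwo ^c |A|"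
  by (simp add: cexp_def ctwo_def Field_card_of card_of_Pow_Func)

text \<open>\<open>GCH\<close> speaks only of infinite cardinals on \<open>'u\<close>, so an
  infinite \<open>A\<close> is first copied into that type, where \<open>C\<close> guarantees room.
  Its power set then has the size of the successor cardinal, which is at most
  \<open>|B|\<close>.\<close>

lemma GCH_card_of_Pow_le:
  fixes C :: "'u set" and A :: "'i set" and B :: "'b set"
  assumes "GCH TYPE('u)" "infinite B" "|A| <o |B|" "|A| \<le>o |C|"
  shows "|Pow A| \<le>o |B|"
proof (cases "finite A")
  case True
  then have "|Pow A| <o |B|"
    using assms(2)
    by (intro finite_ordLess_infinite card_of_Well_order) (simp_all add: Field_card_of)
  then show ?thesis
    by (rule ordLess_imp_ordLeq)
next
  case False
  obtain A' :: "'u set" where A': "|A| =o |A'|"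
    using internalize_card_of_ordLeq2[of A C] assms(4) by blast
  then have "infinite A'"
    using False card_of_ordIso_finite by blast
  then have succ: "ctwo ^c |A'| =o cardSuc |A'|"
    using assms(1) by (simp add: GCH_def Field_card_of card_of_card_order_on)
  have "|Pow A| \<le>o |Pow A'|"
    using A' ordIso_iff_ordLeq card_of_Pow_mono by blast
  also have "|Pow A'| =o ctwo ^c |A'|"
    by (rule card_of_Pow_cexp_ctwo)
  also note succ
  also have "cardSuc |A'| \<le>o |B|"
    by (rule cardSuc_least[OF card_of_Card_order card_of_Card_order
          ordIso_ordLess_trans[OF ordIso_symmetric[OF A'] assms(3)]])
  finally show ?thesis .
qed

theorem corollary2p6:
  fixes X :: "'a topology"
  assumes "GCH TYPE('a)"
    and "infinite (topspace X)"
    and "t0_space X"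
    and "|topspace X| =o ctwo ^c weight X"
  shows "sm X =o weight X"
proof -
  have "is_base X {U. openin X U}"
    by (auto simp: is_base_def)
  then have "\<exists>\<B>. is_base X \<B> \<and> |{U. openin X U}| =o |\<B>|"
    using card_of_refl by blast
  then have "\<exists>\<B>. is_base X \<B> \<and> weight X =o |\<B>|"
    unfolding weight_def by (rule least_ordinal(2)[OF card_of_Well_order])
  then obtain \<B> where \<B>: "is_base X \<B>" "weight X =o |\<B>|"
    by blast
  have "ctwo ^c weight X =o ctwo ^c |\<B>|"
    using \<B>(2) Card_order_ordIso[OF card_of_Card_order \<B>(2)] by (intro cexp_cong2 Card_order_ctwo)
  then have X: "|topspace X| =o |Pow \<B>|"
    by (rule ordIso_transitive[OF assms(4) ordIso_transitive[OF _ ordIso_symmetric[OF card_of_Pow_cexp_ctwo]]])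
  then have inf: "infinite \<B>"
    using assms(2) card_of_ordIso_finite[OF X] by simp
  have sm_set_le: "sm_set Y X \<le>o |\<B>|" for Y
    using sm_set_least(3)[OF assms(3) card_of_Well_order seeker_wins_base[OF assms(3) \<B>(1)]] .
  have wo: "Well_order (sm_set Y X)" and wins: "seeker_wins (sm_set Y X) Y X" for Y
    using sm_set_least(1,2)[OF assms(3) card_of_Well_order seeker_wins_base[OF assms(3) \<B>(1)]] by auto
  note sm = least_ordinal[of "|\<B>|" "\<lambda>\<beta>. \<forall>Y. Y \<subseteq> topspace X \<longrightarrow> sm_set Y X \<le>o \<beta>",
      OF card_of_Well_order, folded sm_def]
  have upper: "sm X \<le>o |\<B>|"
    using sm(3) sm_set_le card_of_Well_order by blast
  have "\<exists>Y \<subseteq> topspace X. \<not> sm_set Y X <o |\<B>|"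
  proof (rule ccontr)
    assume "\<not> ?thesis"
    then have less: "sm_set Y X <o |\<B>|" if "Y \<subseteq> topspace X" for Y
      using that by blast
    \<comment> \<open>Up to isomorphism these initial segments are all the ordinals below
      \<open>|\<B>|\<close>, so the members of \<open>\<B>\<close> index every shorter game
      length.\<close>
    define s where "s p = Restr |\<B>| (underS |\<B>| p)" for p
    have s: "Well_order (s p)" "Field (s p) = underS |\<B>| p" for p
      unfolding s_def
      by (rule Well_order_Restr[OF card_of_Well_order],
          rule Field_Restr_ofilter[OF card_of_Well_order wo_rel.underS_ofilter[OF wo_rel.intro[OF card_of_Well_order]]])
    define W where "W p = {Y. Y \<subseteq> topspace X \<and> seeker_wins (s p) Y X}" for p
    have "|W p| \<le>o |Pow \<B>|" if "p \<in> \<B>" for p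
    proof -
      have "|underS |\<B>| p| <o |\<B>|"
        by (rule card_of_underS[OF card_of_Card_order]) (simp add: that Field_card_of)
      \<comment> \<open>This embeds the segment into the type \<open>'a\<close>, for which
        \<open>GCH\<close> is assumed.\<close>
      moreover from this have "|underS |\<B>| p| \<le>o |topspace X|"
        using ordLess_ordIso_trans[OF card_of_Pow ordIso_symmetric[OF X]]
        by (intro ordLess_imp_ordLeq[OF ordLess_transitive])
      ultimately have "|Pow (Field (s p))| \<le>o |\<B>|"
        using GCH_card_of_Pow_le[OF assms(1) inf] by (simp add: s(2))
      then show ?thesis
        unfolding W_def by (rule card_of_seeker_wins_le[OF s(1) \<B>(1) inf])
    qed
    then have W: "|\<Union>p\<in>\<B>. W p| \<le>o |Pow \<B>|"
      using inf ordLess_imp_ordLeq[OF card_of_Pow[of \<B>]]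
      by (intro card_of_UNION_ordLeq_infinite) auto
    have "Pow (topspace X) \<subseteq> (\<Union>p\<in>\<B>. W p)"
    proof
      fix Y assume "Y \<in> Pow (topspace X)"
      then have Y: "Y \<subseteq> topspace X"
        by simp
      obtain p where "p \<in> \<B>" and iso: "sm_set Y X =o s p"
        using less[OF Y, unfolded ordLess_iff_ordIso_Restr[OF card_of_Well_order wo]]
        by (auto simp: s_def Field_card_of)
      then show "Y \<in> (\<Union>p\<in>\<B>. W p)"
        using seeker_wins_iso[OF iso wins] Y by (auto simp: W_def)
    qed
    \<comment> \<open>If every subset were decided early, \<open>topspace X\<close> would have no
      more subsets than points, against Cantor's theorem.\<close>
    then have "|Pow (topspace X)| \<le>o |\<Union>p\<in>\<B>. W p|"
      by (rule card_of_mono1)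
    also note W
    also have "|Pow \<B>| =o |topspace X|"
      using X by (rule ordIso_symmetric)
    also have "|topspace X| <o |Pow (topspace X)|"
      by (rule card_of_Pow)
    finally show False
      using ordLess_irreflexive by blast
  qed
  then obtain Y where Y: "Y \<subseteq> topspace X" "|\<B>| \<le>o sm_set Y X"
    using wo by (auto simp: not_ordLess_iff_ordLeq card_of_Well_order)
  then have "|\<B>| \<le>o sm X"
    using sm(2) sm_set_le ordLeq_transitive by blast
  then have "sm X =o |\<B>|"
    using upper by (simp add: ordIso_iff_ordLeq)
  then show ?thesis
    by (rule ordIso_transitive[OF _ ordIso_symmetric[OF \<B>(2)]])
qed

end
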